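(* For the finite volume method for the one-dimensional compressible Euler equations with gravity, the source term $S^{\varrho v}$ preserves the hydrostatic balance prescribed by a constant background temperature $T$ if the source term is of the form $$S^{\varrho v}=\{\!\{\varrho\}\!\}_{\log}\,[\![\phi]\!]$$ and the pressure term is discretized as $\{\!\{p\}\!\}$.
   Context: At rest ($v=0$) the momentum equation $\partial_t(\varrho v)+\partial_x(\varrho v^2+p)=-\varrho\,\partial_x\phi$ reduces to the hydrostatic balance $\partial_xp=-\varrho\,\partial_x\phi$, where $\phi=\phi(x)$ is a given time-independent geopotential. With constant temperature $T>0$ and the ideal gas law $p=\varrho RT$ ($R>0$), its solutions are $p=p_0e^{-\phi/(RT)}$, $\varrho=\frac{p_0}{RT}e^{-\phi/(RT)}$, with a constant $p_0>0$. At the interface $i+\frac12$ between cells $i$ and $i+1$: $[\![a]\!]_{i+1/2}=a_{i+1}-a_i$, $\{\!\{a\}\!\}_{i+1/2}=(a_i+a_{i+1})/2$, $\{\!\{a\}\!\}_{\log}=[\![a]\!]/[\![\log a]\!]$ for positive values (equal to $a$ if both values equal $a$). The momentum part of the finite volume method is $\partial_t(\varrho v)_i=-\frac{f^{\varrho v}_{i+1/2}-f^{\varrho v}_{i-1/2}}{\Delta x}-\frac{S^{\varrho v}_{i+1/2}+S^{\varrho v}_{i-1/2}}{2\Delta x}$, and "the pressure term is discretized as $\{\!\{p\}\!\}$" means that for states at rest $f^{\varrho v}_{i+1/2}=\{\!\{p\}\!\}_{i+1/2}$. Preserving the hydrostatic balance means that for grid data $v_i=0$, $p_i=p_0e^{-\phi_i/(RT)}$,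 $\varrho_i=p_i/(RT)$ (arbitrary nodal values $\phi_i$), the momentum right-hand side vanishes for all $i$: $$\frac{\{\!\{p\}\!\}_{i+1/2}-\{\!\{p\}\!\}_{i-1/2}}{\Delta x}+\frac{S^{\varrho v}_{i+1/2}+S^{\varrho v}_{i-1/2}}{2\Delta x}=0.$$ Only the momentum equation is involved; the choice of the remaining thermodynamic variable ($\varrho E$ or $\varrho\theta$) is irrelevant. *)

theory Defs
  imports Complex_Main
begin

text \<open>
  Grid functions are maps from the integers to the reals. A quantity with index \<open>i\<close> that lives
  on interfaces is its value at the interface \<open>i + 1/2\<close> between the cells \<open>i\<close> and \<open>i + 1\<close>; thus
  the interface \<open>i - 1/2\<close> has index \<open>i - 1\<close>.
\<close>

definition jump :: "(int \<Rightarrow> real) \<Rightarrow> int \<Rightarrow> real" where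
  "jump a i = a (i + 1) - a i"

definition arith_mean :: "(int \<Rightarrow> real) \<Rightarrow> int \<Rightarrow> real" where
  "arith_mean a i = (a i + a (i + 1)) / 2"

definition log_mean :: "(int \<Rightarrow> real) \<Rightarrow> int \<Rightarrow> real" where
  "log_mean a i = (if a i = a (i + 1) then a i else jump a i / jump (\<lambda>j. ln (a j)) i)"

text \<open>
  The primitive variables determine the state of an ideal gas, so the choice of the remaining
  conserved thermodynamic variable (total energy or density times potential temperature) need
  not be represented.
\<close>

record grid_state =
  density :: "int \<Rightarrow> real"
  velocity :: "int \<Rightarrow> real"
  pressure :: "int \<Rightarrow> real"

definition admissible :: "grid_state \<Rightarrow> bool" where
  "admissible u \<longleftrightarrow> (\<forall>i. density u i > 0 \<and> pressure u i > 0)"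

definition at_rest :: "grid_state \<Rightarrow> bool" where
  "at_rest u \<longleftrightarrow> (\<forall>i. velocity u i = 0)"

text \<open>
  Right-hand side of the semidiscrete momentum equation in cell \<open>i\<close>, for cell size \<open>dx\<close>,
  numerical momentum flux \<open>f\<close> and momentum source \<open>S\<close>, both mapping grid data to interface values.
\<close>

definition momentum_rhs ::
    "real \<Rightarrow> (grid_state \<Rightarrow> int \<Rightarrow> real) \<Rightarrow> (grid_state \<Rightarrow> int \<Rightarrow> real) \<Rightarrow> grid_state \<Rightarrow> int \<Rightarrow> real" where
  "momentum_rhs dx f S u i =
     - ((f u i - f u (i - 1)) / dx) - (S u i + S u (i - 1)) / (2 * dx)"

text \<open>
  The flux at nonzero velocity is left unconstrained: the pressure discretization fixes it only
  for states at rest, where the convective part vanishes.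
\<close>

definition pressure_as_arith_mean :: "(grid_state \<Rightarrow> int \<Rightarrow> real) \<Rightarrow> bool" where
  "pressure_as_arith_mean f \<longleftrightarrow>
     (\<forall>u. admissible u \<longrightarrow> at_rest u \<longrightarrow> (\<forall>i. f u i = arith_mean (pressure u) i))"

definition source_of_log_mean_form ::
    "(int \<Rightarrow> real) \<Rightarrow> (grid_state \<Rightarrow> int \<Rightarrow> real) \<Rightarrow> bool" where
  "source_of_log_mean_form \<phi> S \<longleftrightarrow>
     (\<forall>u. admissible u \<longrightarrow> (\<forall>i. S u i = log_mean (density u) i * jump \<phi> i))"

definition isothermal_state :: "real \<Rightarrow> real \<Rightarrow> real \<Rightarrow> (int \<Rightarrow> real) \<Rightarrow> grid_state" where
  "isothermal_state R T p0 \<phi> =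
     \<lparr> density = (\<lambda>i. p0 * exp (- \<phi> i / (R * T)) / (R * T)),
       velocity = (\<lambda>i. 0),
       pressure = (\<lambda>i. p0 * exp (- \<phi> i / (R * T))) \<rparr>"

definition preserves_isothermal_balance ::
    "real \<Rightarrow> real \<Rightarrow> real \<Rightarrow> (int \<Rightarrow> real) \<Rightarrow>
     (grid_state \<Rightarrow> int \<Rightarrow> real) \<Rightarrow> (grid_state \<Rightarrow> int \<Rightarrow> real) \<Rightarrow> bool" where
  "preserves_isothermal_balance R T dx \<phi> f S \<longleftrightarrow>
     (\<forall>p0 > 0. \<forall>i. momentum_rhs dx f S (isothermal_state R T p0 \<phi>) i = 0)"

end

theory Submission
  imports Defs
begin

text \<open>
  The logarithmic mean is the discrete chain rule for the logarithm:
  the product of \<open>log_mean a\<close> and the jump of \<open>ln a\<close> is the jump of \<open>a\<close>. In an isothermal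
  state \<open>ln \<rho>\<close> equals \<open>- \<phi> / (R * T)\<close> up to a constant, so at each interface the source
  \<open>log_mean \<rho> * jump \<phi>\<close> equals \<open>- R * T * jump \<rho> = - jump p\<close>. The difference of the arithmetic
  means of \<open>p\<close> at the two interfaces of a cell is half the sum of the jumps of \<open>p\<close> there, and
  this is exactly what the averaged source terms cancel.
\<close>

lemma log_mean_mult_jump_ln:
  assumes "a i > 0" and "a (i + 1) > 0"
  shows "log_mean a i * jump (\<lambda>j. ln (a j)) i = jump a i"
  using assms by (simp add: log_mean_def jump_def)

lemma arith_mean_diff:
  "arith_mean a i - arith_mean a (i - 1) = (jump a i + jump a (i - 1)) / 2"
  by (simp add: arith_mean_def jump_def field_simps)

lemma admissible_isothermal_state:
  assumes "R * T > 0" and "p0 > 0"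
  shows "admissible (isothermal_state R T p0 \<phi>)"
  using assms by (simp add: admissible_def isothermal_state_def)

lemma at_rest_isothermal_state: "at_rest (isothermal_state R T p0 \<phi>)"
  by (simp add: at_rest_def isothermal_state_def)

lemma pressure_isothermal_state:
  assumes "R * T \<noteq> 0"
  shows "pressure (isothermal_state R T p0 \<phi>) i = R * T * density (isothermal_state R T p0 \<phi>) i"
  using assms by (simp add: isothermal_state_def)

lemma jump_ln_density_isothermal_state:
  assumes "R * T > 0" and "p0 > 0"
  shows "jump (\<lambda>j. ln (density (isothermal_state R T p0 \<phi>) j)) i = - jump \<phi> i / (R * T)"
proof -
  have "ln (density (isothermal_state R T p0 \<phi>) j) = ln (p0 / (R * T)) - \<phi> j / (R * T)" for j
  proof -
    have "density (isothermal_state R T p0 \<phi>) j = p0 / (R * T) * exp (- \<phi> j / (R * T))"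
      by (simp add: isothermal_state_def)
    moreover have "p0 / (R * T) > 0"
      using assms by (rule divide_pos_pos[rotated])
    ultimately show ?thesis
      by (simp only: ln_mult_pos exp_gt_zero ln_exp)
  qed
  then show ?thesis
    by (simp add: jump_def diff_divide_distrib)
qed

text \<open>The discrete form, at a single interface, of the balance \<open>\<partial>\<^sub>x p = - \<rho> \<partial>\<^sub>x \<phi>\<close>.\<close>

lemma log_mean_density_mult_jump_potential:
  fixes R T p0 :: real and \<phi> :: "int \<Rightarrow> real"
  defines "u \<equiv> isothermal_state R T p0 \<phi>"
  assumes RT: "R * T > 0" and p0: "p0 > 0"
  shows "log_mean (density u) i * jump \<phi> i = - jump (pressure u) i"
proof -
  have pos: "density u j > 0" for j
    using admissible_isothermal_state[OF RT p0] by (simp add: admissible_def u_def)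
  have "jump \<phi> i = - (R * T) * jump (\<lambda>j. ln (density u j)) i"
    unfolding u_def jump_ln_density_isothermal_state[OF RT p0] using RT by auto
  then have "log_mean (density u) i * jump \<phi> i
      = - (R * T) * (log_mean (density u) i * jump (\<lambda>j. ln (density u j)) i)"
    by (simp only: mult.left_commute)
  also have "\<dots> = - (R * T) * jump (density u) i"
    by (simp only: log_mean_mult_jump_ln[OF pos pos])
  also have "\<dots> = - jump (pressure u) i"
    unfolding jump_def u_def pressure_isothermal_state[OF less_imp_neq[OF RT, symmetric]]
    by (simp add: algebra_simps)
  finally show ?thesis .
qed

theorem lemma4p4:
  fixes R T dx :: real
    and \<phi> :: "int \<Rightarrow> real"
    and f S :: "grid_state \<Rightarrow> int \<Rightarrow> real"
  assumes "R > 0" and "T > 0" and "dx > 0"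
    and "pressure_as_arith_mean f"
    and "source_of_log_mean_form \<phi> S"
  shows "preserves_isothermal_balance R T dx \<phi> f S"
  unfolding preserves_isothermal_balance_def
proof (intro allI impI)
  fix p0 :: real and i :: int
  assume p0: "p0 > 0"
  define u where "u = isothermal_state R T p0 \<phi>"
  have RT: "R * T > 0"
    using assms(1,2) by simp
  have adm: "admissible u"
    unfolding u_def by (rule admissible_isothermal_state[OF RT p0])
  have flux: "f u j = arith_mean (pressure u) j" for j
    using assms(4) adm at_rest_isothermal_state by (simp add: pressure_as_arith_mean_def u_def)
  have source: "S u j = - jump (pressure u) j" for j
    using assms(5) adm log_mean_density_mult_jump_potential[OF RT p0]
    by (simp add: source_of_log_mean_form_def u_def)
  have "momentum_rhs dx f S u i = 0"
    unfolding momentum_rhs_def flux source arith_mean_diff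
    by (simp add: add_divide_distrib diff_divide_distrib)
  then show "momentum_rhs dx f S (isothermal_state R T p0 \<phi>) i = 0"
    by (simp add: u_def)
qed

end
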